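(* Let $I$ be a compact metric space and let $Y$ be a non-empty complete metric space with distance $d_Y$. Let $\mathcal{S}$ be the set of upper semi-continuous maps from $I$ to the set $\mathcal{H}$ of non-empty compact subsets of $Y$; equivalently, $\mathcal{S}$ is the set of compact subsets $K\subset I\times Y$ that project onto $I$. Suppose given: (i) a countable (possibly finite) cover $\{I_\alpha\}_{\alpha\in\mathcal{A}}$ of $I$ by compact subsets of $I$; (ii) a family $T$ of continuous maps $T_\alpha: I_\alpha\to I$, $\alpha\in\mathcal{A}$, such that $\{T_\alpha(I_\alpha)\}_{\alpha\in\mathcal{A}}$ is a cover of $I$; (iii) a family of continuous maps $S_\alpha: I_\alpha\times Y\to Y$, $\alpha\in\mathcal{A}$, which is uniformly contracting, i.e. there is a constant $0<c<1$ such that $d_Y(S_\alpha(x,y),S_\alpha(x,z))\le c\, d_Y(y,z)$ for all $\alpha\in\mathcal{A}$, $x\in I_\alpha$ and $y,z\in Y$, and which satisfies the boundedness condition that for every $y\in Y$ the set $\{S_\alpha(x,y) \mid \alpha\in\mathcal{A},\ x\in I_\alpha\}$ is totally bounded in $Y$. For each $\alpha\in\mathcal{A}$ define $\widetilde T_\alpha: I_\alpha\times Y\to I\times Y$ by $\widetilde T_\alpha(x,y)=(T_\alpha(x),S_\alpha(x,y))$, and define $\Theta:\mathcal{S}\to\mathcal{S}$ by $$\Theta(K)=\overline{\bigcup_{\alpha\in\mathcal{A}}\widetilde T_\alpha(K_\alpha)},\qquad K_\alpha=\{(x,y)\in K\mid x\in I_\alpha\},$$ the closure being taken in $I\times Y$.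 Then $\Theta$ has a unique fixed point in $\mathcal{S}$.
   Context: A map $K:I\to\mathcal{H}$ is identified with the subset $\{(x,y)\in I\times Y\mid y\in K(x)\}$ of $I\times Y$; conversely, a subset $K\subset I\times Y$ projecting onto $I$ and having compact fibers $K(x)=\{y\in Y\mid (x,y)\in K\}$ is identified with the map $x\mapsto K(x)$. A map $K:I\to\mathcal{H}$ is upper semi-continuous if for every $x\in I$ and $\epsilon>0$ there is $\delta>0$ such that $d_I(x,x')<\delta$ implies $K(x')\subset\{y\in Y\mid d_Y(y,K(x))\le\epsilon\}$, where $d_Y(y,A)=\inf_{z\in A}d_Y(y,z)$. Under this identification, upper semi-continuous maps $I\to\mathcal{H}$ correspond exactly to compact subsets of $I\times Y$ projecting onto $I$. The set $\mathcal{S}$ carries the uniform distance $d_{\mathcal{S}}(K,K')=\sup_{x\in I}d_H(K(x),K'(x))$, where $d_H$ is the Hausdorff distance on $\mathcal{H}$. The boundedness condition on the family $(S_\alpha)$ ensures that $\Theta(K)$ is compact for every $K\in\mathcal{S}$, so that $\Theta$ does map $\mathcal{S}$ to $\mathcal{S}$. *)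

theory Defs
  imports "HOL-Analysis.Analysis"
begin

text \<open>The spaces are carrier sets \<open>I\<close>, \<open>Y\<close> in ambient metric types, with the restricted
  distance.\<close>

definition nonempty_compacts :: "'b::metric_space set \<Rightarrow> 'b set set" where
  "nonempty_compacts Y = {C. C \<subseteq> Y \<and> C \<noteq> {} \<and> compact C}"

text \<open>As \<open>F x\<close> is nonempty, \<open>infdist y (F x)\<close> is the infimum of \<open>dist y z\<close> over \<open>z \<in> F x\<close>.\<close>

definition usc_map :: "'a::metric_space set \<Rightarrow> 'b::metric_space set \<Rightarrow> ('a \<Rightarrow> 'b set) \<Rightarrow> bool" where
  "usc_map I Y F \<longleftrightarrow>
     (\<forall>x\<in>I. F x \<in> nonempty_compacts Y) \<and>
     (\<forall>x\<in>I. \<forall>\<epsilon>>0. \<exists>\<delta>>0. \<forall>x'\<in>I. dist x x' < \<delta> \<longrightarrow>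
        F x' \<subseteq> {y \<in> Y. infdist y (F x) \<le> \<epsilon>})"

text \<open>A map \<open>F\<close> on \<open>I\<close> is identified with the subset \<open>Sigma I F\<close> of \<open>I \<times> Y\<close>; values of
  \<open>F\<close> outside \<open>I\<close> are thereby ignored.\<close>

definition usc_graphs :: "'a::metric_space set \<Rightarrow> 'b::metric_space set \<Rightarrow> ('a \<times> 'b) set set" where
  "usc_graphs I Y = {Sigma I F | F. usc_map I Y F}"

definition skew_map :: "('a \<Rightarrow> 'a) \<Rightarrow> ('a \<times> 'b \<Rightarrow> 'b) \<Rightarrow> 'a \<times> 'b \<Rightarrow> 'a \<times> 'b" where
  "skew_map t s = (\<lambda>(x, y). (t x, s (x, y)))"

definition Theta ::
  "'a::metric_space set \<Rightarrow> 'b::metric_space set \<Rightarrow> 'k set \<Rightarrow> ('k \<Rightarrow> 'a set) \<Rightarrow>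
   ('k \<Rightarrow> 'a \<Rightarrow> 'a) \<Rightarrow> ('k \<Rightarrow> 'a \<times> 'b \<Rightarrow> 'b) \<Rightarrow> ('a \<times> 'b) set \<Rightarrow> ('a \<times> 'b) set" where
  "Theta I Y A J T S K =
     top_of_set (I \<times> Y) closure_of
       (\<Union>\<alpha>\<in>A. skew_map (T \<alpha>) (S \<alpha>) ` {(x, y) \<in> K. x \<in> J \<alpha>})"

lemma compact_Sigma_usc:
  fixes I :: "'a::metric_space set" and Y :: "'b::metric_space set"
  assumes I: "compact I" and F: "usc_map I Y F"
  shows "compact (Sigma I F)"
proof -
  have "seq_compact (Sigma I F)"
  proof (rule seq_compactI)
    fix f :: "nat \<Rightarrow> 'a \<times> 'b" assume f: "\<forall>n. f n \<in> Sigma I F"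
    define u v where "u n = fst (f n)" and "v n = snd (f n)" for n
    have u: "u n \<in> I" and v: "v n \<in> F (u n)" for n
      using f[rule_format, of n] by (auto simp: u_def v_def)
    obtain x r where x: "x \<in> I" and r: "strict_mono r" and lim: "(u \<circ> r) \<longlonglongrightarrow> x"
      using I u unfolding compact_eq_seq_compact_metric seq_compact_def by blast
    have Fx: "compact (F x)" "F x \<noteq> {}"
      using F x by (auto simp: usc_map_def nonempty_compacts_def)
    have "\<exists>z\<in>F x. \<forall>w\<in>F x. dist (v n) z \<le> dist (v n) w" for n
      by (rule continuous_attains_inf[OF Fx]) (intro continuous_intros)
    then obtain z where z: "z n \<in> F x" and zmin: "w \<in> F x \<Longrightarrow> dist (v n) (z n) \<le> dist (v n) w" for n w
      by metis
    have zinf: "dist (v n) (z n) \<le> infdist (v n) (F x)" for n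
      using Fx(2) zmin by (auto simp: infdist_def intro!: cINF_greatest)
    have dz: "(\<lambda>n. dist (v (r n)) (z (r n))) \<longlonglongrightarrow> 0"
    proof (rule metric_LIMSEQ_I)
      fix e :: real assume e: "e > 0"
      then obtain d where "d > 0" and
        d: "\<And>x'. x' \<in> I \<Longrightarrow> dist x x' < d \<Longrightarrow> F x' \<subseteq> {y \<in> Y. infdist y (F x) \<le> e / 2}"
        using F x unfolding usc_map_def by (metis half_gt_zero)
      then obtain N where N: "\<And>n. n \<ge> N \<Longrightarrow> dist (u (r n)) x < d"
        using metric_LIMSEQ_D[OF lim \<open>d > 0\<close>] by auto
      have "dist (dist (v (r n)) (z (r n))) 0 < e" if "n \<ge> N" for n
      proof -
        have "infdist (v (r n)) (F x) \<le> e / 2"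
          using d[OF u, of "r n"] N[OF that] v[of "r n"] by (auto simp: dist_commute)
        with zinf[of "r n"] e show ?thesis by simp
      qed
      then show "\<exists>N. \<forall>n\<ge>N. dist (dist (v (r n)) (z (r n))) 0 < e" by blast
    qed
    obtain l q where l: "l \<in> F x" and q: "strict_mono q" and zl: "((\<lambda>n. z (r n)) \<circ> q) \<longlonglongrightarrow> l"
      using Fx(1) z unfolding compact_eq_seq_compact_metric seq_compact_def by metis
    have "(\<lambda>n. v (r (q n))) \<longlonglongrightarrow> l"
    proof -
      have 1: "(\<lambda>n. dist (v (r (q n))) (z (r (q n)))) \<longlonglongrightarrow> 0"
        using LIMSEQ_subseq_LIMSEQ[OF dz q] by (simp add: o_def)
      have 2: "(\<lambda>n. dist (z (r (q n))) l) \<longlonglongrightarrow> 0"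
        using zl unfolding o_def by (rule tendsto_dist_iff[THEN iffD1])
      have "(\<lambda>n. dist (v (r (q n))) l) \<longlonglongrightarrow> 0"
        by (rule tendsto_sandwich[OF _ _ tendsto_const tendsto_add_zero[OF 1 2]])
          (auto intro!: always_eventually dist_triangle)
      then show ?thesis by (rule tendsto_dist_iff[THEN iffD2])
    qed
    moreover have "(\<lambda>n. u (r (q n))) \<longlonglongrightarrow> x"
      using LIMSEQ_subseq_LIMSEQ[OF lim q] by (simp add: o_def)
    ultimately have "(\<lambda>n. (u (r (q n)), v (r (q n)))) \<longlonglongrightarrow> (x, l)"
      by (intro tendsto_Pair)
    then have "(f \<circ> (r \<circ> q)) \<longlonglongrightarrow> (x, l)" by (simp add: o_def u_def v_def)
    moreover have "strict_mono (r \<circ> q)" using r q by (rule strict_mono_o)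
    ultimately show "\<exists>l\<in>Sigma I F. \<exists>r. strict_mono r \<and> (f \<circ> r) \<longlonglongrightarrow> l"
      using x l by blast
  qed
  then show ?thesis by (simp add: compact_eq_seq_compact_metric)
qed

lemma compact_fibre:
  fixes K :: "('a::metric_space \<times> 'b::metric_space) set"
  assumes "compact K"
  shows "compact (K `` {x})"
proof -
  have "K `` {x} = snd ` (K \<inter> ({x} \<times> UNIV))" by force
  moreover have "compact (K \<inter> ({x} \<times> UNIV))"
    using assms by (intro compact_Int_closed closed_Times) auto
  moreover from this have "compact (snd ` (K \<inter> ({x} \<times> UNIV)))"
    by (intro compact_continuous_image continuous_intros)
  ultimately show ?thesis by simp
qed

lemma usc_map_fibres:
  fixes K :: "('a::metric_space \<times> 'b::metric_space) set"
  assumes K: "compact K" and sub: "K \<subseteq> I \<times> Y" and proj: "fst ` K = I"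
  shows "usc_map I Y (\<lambda>x. K `` {x})"
  unfolding usc_map_def
proof (intro conjI ballI allI impI)
  fix x assume "x \<in> I"
  then have "K `` {x} \<noteq> {}" using proj by force
  moreover have "K `` {x} \<subseteq> Y" using sub by auto
  ultimately show "K `` {x} \<in> nonempty_compacts Y"
    using compact_fibre[OF K] by (simp add: nonempty_compacts_def)
next
  fix x and e :: real assume x: "x \<in> I" and e: "e > 0"
  define C where "C = K \<inter> {p. e \<le> infdist (snd p) (K `` {x})}"
  have "compact C" unfolding C_def
    by (intro compact_Int_closed K closed_Collect_le continuous_intros)
  then have "compact (fst ` C)"
    by (intro compact_continuous_image continuous_intros)
  then have "open (- (fst ` C))" by (simp add: compact_imp_closed open_Compl)
  moreover have "x \<in> - (fst ` C)"
  proof -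
    have "infdist y (K `` {x}) = 0" if "(x, y) \<in> K" for y
      using that by (intro infdist_zero) auto
    with e show ?thesis by (force simp: C_def)
  qed
  ultimately obtain d where d: "d > 0" "ball x d \<subseteq> - (fst ` C)"
    by (meson open_contains_ball)
  have "K `` {x'} \<subseteq> {y \<in> Y. infdist y (K `` {x}) \<le> e}" if "dist x x' < d" for x'
  proof
    fix y assume y: "y \<in> K `` {x'}"
    have "(x', y) \<notin> C" using d(2) that by (force simp: subset_iff)
    with y sub show "y \<in> {y \<in> Y. infdist y (K `` {x}) \<le> e}" by (auto simp: C_def)
  qed
  with d(1) show "\<exists>d>0. \<forall>x'\<in>I. dist x x' < d \<longrightarrow>
      K `` {x'} \<subseteq> {y \<in> Y. infdist y (K `` {x}) \<le> e}" by blast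
qed

lemma usc_graphs_eq:
  fixes I :: "'a::metric_space set" and Y :: "'b::metric_space set"
  assumes "compact I"
  shows "usc_graphs I Y = {K. compact K \<and> K \<subseteq> I \<times> Y \<and> fst ` K = I}"
proof (intro equalityI subsetI)
  fix K assume "K \<in> usc_graphs I Y"
  then obtain F where K: "K = Sigma I F" and F: "usc_map I Y F"
    by (auto simp: usc_graphs_def)
  have ne: "F x \<noteq> {} \<and> F x \<subseteq> Y" if "x \<in> I" for x
    using F that by (auto simp: usc_map_def nonempty_compacts_def)
  then have "fst ` K = I" unfolding K by force
  moreover have "K \<subseteq> I \<times> Y" using ne K by auto
  ultimately show "K \<in> {K. compact K \<and> K \<subseteq> I \<times> Y \<and> fst ` K = I}"
    using compact_Sigma_usc[OF assms F] K by simp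
next
  fix K assume K: "K \<in> {K. compact K \<and> K \<subseteq> I \<times> Y \<and> fst ` K = I}"
  then have "usc_map I Y (\<lambda>x. K `` {x})" by (intro usc_map_fibres) auto
  moreover have "K = Sigma I (\<lambda>x. K `` {x})" using K by auto
  ultimately show "K \<in> usc_graphs I Y" unfolding usc_graphs_def by blast
qed

lemma Theta_eq_closure:
  assumes "compact I" "complete Y" "\<And>\<alpha>. \<alpha> \<in> A \<Longrightarrow> T \<alpha> ` J \<alpha> \<subseteq> I"
    and "\<And>\<alpha>. \<alpha> \<in> A \<Longrightarrow> S \<alpha> ` (J \<alpha> \<times> Y) \<subseteq> Y" and "K \<subseteq> I \<times> Y"
  shows "Theta I Y A J T S K =
    closure (\<Union>\<alpha>\<in>A. skew_map (T \<alpha>) (S \<alpha>) ` {(x, y) \<in> K. x \<in> J \<alpha>})" (is "_ = closure ?U")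
proof -
  have "closed (I \<times> Y)"
    using assms(1,2) by (intro closed_Times) (auto simp: compact_imp_closed complete_imp_closed)
  moreover have U: "?U \<subseteq> I \<times> Y"
    using assms(3-5) by (fastforce simp: skew_map_def)
  ultimately have "closure ?U \<subseteq> I \<times> Y" by (rule closure_minimal[rotated])
  with U show ?thesis
    unfolding Theta_def closure_of_subtopology by (auto simp: Int_absorb1)
qed

lemma Theta_in_usc_graphs:
  fixes I :: "'a::metric_space set" and Y :: "'b::metric_space set"
  assumes I: "compact I" and Y: "complete Y"
    and T: "\<And>\<alpha>. \<alpha> \<in> A \<Longrightarrow> T \<alpha> ` J \<alpha> \<subseteq> I" and T_cover: "I \<subseteq> (\<Union>\<alpha>\<in>A. T \<alpha> ` J \<alpha>)"
    and J: "\<And>\<alpha>. \<alpha> \<in> A \<Longrightarrow> J \<alpha> \<subseteq> I"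
    and S: "\<And>\<alpha>. \<alpha> \<in> A \<Longrightarrow> S \<alpha> ` (J \<alpha> \<times> Y) \<subseteq> Y"
    and c: "0 < c" "c < 1"
    and contr: "\<And>\<alpha> x y z. \<alpha> \<in> A \<Longrightarrow> x \<in> J \<alpha> \<Longrightarrow> y \<in> Y \<Longrightarrow> z \<in> Y \<Longrightarrow>
      dist (S \<alpha> (x, y)) (S \<alpha> (x, z)) \<le> c * dist y z"
    and tb: "\<And>y. y \<in> Y \<Longrightarrow> totally_bounded {S \<alpha> (x, y) | \<alpha> x. \<alpha> \<in> A \<and> x \<in> J \<alpha>}"
    and K: "K \<in> usc_graphs I Y"
  shows "Theta I Y A J T S K \<in> usc_graphs I Y"
proof -
  define U where "U = (\<Union>\<alpha>\<in>A. skew_map (T \<alpha>) (S \<alpha>) ` {(x, y) \<in> K. x \<in> J \<alpha>})"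
  have K': "compact K" "K \<subseteq> I \<times> Y" "fst ` K = I"
    using K[unfolded usc_graphs_eq[OF I]] by blast+
  have eq: "Theta I Y A J T S K = closure U"
    unfolding U_def by (rule Theta_eq_closure) (use I Y T S K' in auto)
  define B where "B y = {S \<alpha> (x, y) | \<alpha> x. \<alpha> \<in> A \<and> x \<in> J \<alpha>}" for y
  define V where "V = {S \<alpha> (x, y) | \<alpha> x y. \<alpha> \<in> A \<and> x \<in> J \<alpha> \<and> (x, y) \<in> K}"
  have VY: "V \<subseteq> Y" using S K'(2) unfolding V_def by fast
  have V: "totally_bounded V"
    unfolding totally_bounded_metric
  proof (intro allI impI)
    fix e :: real assume e: "e > 0"
    have "compact (snd ` K)" using K'(1) by (intro compact_continuous_image continuous_intros)
    then obtain P where P: "finite P" "P \<subseteq> snd ` K" "snd ` K \<subseteq> (\<Union>p\<in>P. ball p (e / 2))"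
      using seq_compact_imp_totally_bounded[OF compact_imp_seq_compact, rule_format, of "snd ` K" "e / 2"] e
      by auto
    have PY: "P \<subseteq> Y" using P(2) K'(2) by fastforce
    have "\<exists>k. finite k \<and> B p \<subseteq> (\<Union>q\<in>k. {y. dist q y < e / 2})" if "p \<in> P" for p
      using tb[of p] that PY e unfolding B_def totally_bounded_metric
      by (meson half_gt_zero subsetD)
    then obtain k where k: "\<And>p. p \<in> P \<Longrightarrow> finite (k p)"
      "\<And>p. p \<in> P \<Longrightarrow> B p \<subseteq> (\<Union>q\<in>k p. {y. dist q y < e / 2})" by metis
    have "V \<subseteq> (\<Union>q\<in>(\<Union>p\<in>P. k p). {y. dist q y < e})"
    proof
      fix w assume "w \<in> V"
      then obtain \<alpha> x y where w: "w = S \<alpha> (x, y)" "\<alpha> \<in> A" "x \<in> J \<alpha>" "(x, y) \<in> K"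
        unfolding V_def by blast
      then have "y \<in> snd ` K" by force
      then obtain p where p: "p \<in> P" "dist p y < e / 2" using P(3) by auto
      have "S \<alpha> (x, p) \<in> B p" using w unfolding B_def by blast
      then obtain q where q: "q \<in> k p" "dist q (S \<alpha> (x, p)) < e / 2" using k(2)[OF p(1)] by auto
      have "dist (S \<alpha> (x, p)) w \<le> c * dist p y"
        using contr[of \<alpha> x p y] w p PY K'(2) by auto
      also have "\<dots> \<le> dist p y" using c by (simp add: mult_left_le_one_le)
      finally have "dist q w < e" using p q dist_triangle[of q w "S \<alpha> (x, p)"] by linarith
      then show "w \<in> (\<Union>q\<in>(\<Union>p\<in>P. k p). {y. dist q y < e})" using p q by blast
    qed
    then show "\<exists>k. finite k \<and> V \<subseteq> (\<Union>x\<in>k. {y. dist x y < e})"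
      using P(1) k(1) by (intro exI[of _ "\<Union>p\<in>P. k p"]) auto
  qed
  have "compact (closure V)"
    unfolding compact_eq_totally_bounded
  proof (intro conjI allI impI)
    have "closure V \<subseteq> Y" using VY Y by (simp add: closure_minimal complete_imp_closed)
    then show "complete (closure V)"
      using complete_Int_closed[OF Y closed_closure, of V] by (simp add: Int_absorb1)
    fix e :: real assume e: "e > 0"
    then obtain k where k: "finite k" "V \<subseteq> (\<Union>x\<in>k. {y. dist x y < e / 2})"
      using V unfolding totally_bounded_metric by (meson half_gt_zero)
    have "closure V \<subseteq> (\<Union>x\<in>k. cball x (e / 2))"
    proof (rule closure_minimal)
      show "V \<subseteq> (\<Union>x\<in>k. cball x (e / 2))"
        using k(2) by (auto simp: subset_iff) (meson less_imp_le)
      show "closed (\<Union>x\<in>k. cball x (e / 2))" using k(1) by (intro closed_UN) auto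
    qed
    also have "\<dots> \<subseteq> (\<Union>x\<in>k. ball x e)"
    proof (rule UN_mono)
      show "cball x (e / 2) \<subseteq> ball x e" for x using e by auto
    qed simp
    finally show "\<exists>k. finite k \<and> closure V \<subseteq> (\<Union>x\<in>k. ball x e)" using k(1) by blast
  qed
  then have comp: "compact (I \<times> closure V)" using I by (rule compact_Times[rotated])
  have UV: "U \<subseteq> I \<times> V"
  proof
    fix p assume "p \<in> U"
    then obtain \<alpha> x y where p: "p = (T \<alpha> x, S \<alpha> (x, y))" "\<alpha> \<in> A" "x \<in> J \<alpha>" "(x, y) \<in> K"
      unfolding U_def skew_map_def by auto
    then have "T \<alpha> x \<in> I" using T by blast
    moreover have "S \<alpha> (x, y) \<in> V" unfolding V_def using p by blast
    ultimately show "p \<in> I \<times> V" using p(1) by simp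
  qed
  then have "closure U \<subseteq> I \<times> closure V"
    using comp closure_subset[of V] by (intro closure_minimal) (auto simp: compact_imp_closed)
  moreover from this have "compact (closure U)"
    using comp by (metis closed_closure compact_Int_closed inf.absorb2)
  moreover have "closure V \<subseteq> Y" using VY Y by (simp add: closure_minimal complete_imp_closed)
  moreover have "I \<subseteq> fst ` closure U"
  proof
    fix x assume "x \<in> I"
    then obtain \<alpha> x' where a: "\<alpha> \<in> A" "x' \<in> J \<alpha>" "x = T \<alpha> x'" using T_cover by auto
    then obtain y where "(x', y) \<in> K" using K'(3) J by force
    then have "skew_map (T \<alpha>) (S \<alpha>) (x', y) \<in> U" using a unfolding U_def by blast
    then show "x \<in> fst ` closure U" using a closure_subset[of U] by (force simp: skew_map_def)
  qed
  ultimately show ?thesis unfolding eq usc_graphs_eq[OF I] by auto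
qed

end

theory Submission
  imports Defs
begin

text \<open>
  Comparing subsets of \<open>I \<times> Y\<close> fibre by fibre, \<open>\<Theta>\<close> contracts distances by the factor \<open>c\<close>: a point of
  \<open>\<Theta>(K)\<close> is a limit of points \<open>(T\<^sub>\<alpha>(x), S\<^sub>\<alpha>(x, y))\<close> with \<open>(x, y) \<in> K\<close>; replacing \<open>y\<close> by a nearby \<open>z\<close> in the
  fibre of \<open>K'\<close> over \<open>x\<close> does not change the first coordinate of the image, and a subsequence of
  the new images converges because \<open>\<Theta>(K')\<close> is compact. Hence the iterates of \<open>I \<times> {y\<^sub>0}\<close> are Cauchy for
  the uniform Hausdorff distance, and they converge to the set of their accumulation points,
  which is compact since \<open>Y\<close> is complete.
\<close>

section \<open>One-sided fibrewise distance between subsets of a product\<close>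

text \<open>The two conditions \<open>fibre_near r K L\<close> and \<open>fibre_near r L K\<close> together say that
  \<open>d\<^sub>\<S>(K, L) \<le> r\<close>, provided the fibres are compact.\<close>

definition fibre_near :: "real \<Rightarrow> ('a \<times> 'b::metric_space) set \<Rightarrow> ('a \<times> 'b) set \<Rightarrow> bool" where
  "fibre_near r K L \<longleftrightarrow> (\<forall>(x, y)\<in>K. \<exists>z. (x, z) \<in> L \<and> dist y z \<le> r)"

lemma fibre_nearI:
  "(\<And>x y. (x, y) \<in> K \<Longrightarrow> \<exists>z. (x, z) \<in> L \<and> dist y z \<le> r) \<Longrightarrow> fibre_near r K L"
  by (auto simp: fibre_near_def)

lemma fibre_nearE:
  assumes "fibre_near r K L" "(x, y) \<in> K"
  obtains z where "(x, z) \<in> L" "dist y z \<le> r"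
  using assms by (auto simp: fibre_near_def)

lemma fibre_near_mono:
  "fibre_near r K L \<Longrightarrow> r \<le> s \<Longrightarrow> L \<subseteq> L' \<Longrightarrow> fibre_near s K L'"
  unfolding fibre_near_def by (blast intro: order_trans)

lemma fibre_near_refl: "0 \<le> r \<Longrightarrow> fibre_near r K K"
  by (rule fibre_nearI) (metis dist_self)

lemma fibre_near_trans:
  assumes "fibre_near r K L" "fibre_near s L M"
  shows "fibre_near (r + s) K M"
proof (rule fibre_nearI)
  fix x y assume "(x, y) \<in> K"
  then obtain z where z: "(x, z) \<in> L" "dist y z \<le> r" by (rule fibre_nearE[OF assms(1)])
  then obtain w where "(x, w) \<in> M" "dist z w \<le> s" by (meson fibre_nearE[OF assms(2)])
  with z show "\<exists>w. (x, w) \<in> M \<and> dist y w \<le> r + s"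
    by (intro exI[of _ w]) (use dist_triangle[of y w z] in auto)
qed

lemma fibre_near_fst: "fibre_near r K L \<Longrightarrow> fst ` K \<subseteq> fst ` L"
  by (force elim: fibre_nearE)

text \<open>For a sequence in \<open>K\<close> tending to \<open>(x, y)\<close>, the partners in
  \<open>L\<close> have a convergent subsequence by compactness. Its limit lies over
  \<open>x\<close> since partners share first coordinates, and the non-strict bound \<open>r\<close>
  survives.\<close>

lemma fibre_near_closure:
  fixes K L :: "('a::metric_space \<times> 'b::metric_space) set"
  assumes near: "fibre_near r K L" and L: "compact L"
  shows "fibre_near r (closure K) L"
proof (rule fibre_nearI)
  fix x y assume "(x, y) \<in> closure K"
  then obtain p where p: "\<And>n. p n \<in> K" "p \<longlonglongrightarrow> (x, y)" by (auto simp: closure_sequential)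
  have "\<exists>z. (fst (p n), z) \<in> L \<and> dist (snd (p n)) z \<le> r" for n
    using near p(1)[of n] by (auto simp: fibre_near_def split: prod.splits)
  then obtain z where z: "\<And>n. (fst (p n), z n) \<in> L" "\<And>n. dist (snd (p n)) (z n) \<le> r"
    by metis
  obtain l s where l: "l \<in> L" "strict_mono s" and lim: "(\<lambda>n. (fst (p (s n)), z (s n))) \<longlonglongrightarrow> l"
    using seq_compactE[OF compact_imp_seq_compact[OF L], of "\<lambda>n. (fst (p n), z n)"] z(1)
    by (auto simp: o_def)
  have ps: "(\<lambda>n. p (s n)) \<longlonglongrightarrow> (x, y)"
    using LIMSEQ_subseq_LIMSEQ[OF p(2) l(2)] by (simp add: o_def)
  have "(\<lambda>n. fst (p (s n))) \<longlonglongrightarrow> fst l" using tendsto_fst[OF lim] by simp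
  then have "x = fst l" using tendsto_fst[OF ps] LIMSEQ_unique by fastforce
  moreover have "dist y (snd l) \<le> r"
  proof (rule LIMSEQ_le_const2)
    show "(\<lambda>n. dist (snd (p (s n))) (z (s n))) \<longlonglongrightarrow> dist y (snd l)"
      using tendsto_dist[OF tendsto_snd[OF ps] tendsto_snd[OF lim]] by simp
  qed (use z(2) in auto)
  ultimately show "\<exists>z. (x, z) \<in> L \<and> dist y z \<le> r" using l(1) by (intro exI[of _ "snd l"]) simp
qed

text \<open>The partners of \<open>(x, y)\<close> all lie over \<open>x\<close> and converge to
  \<open>(x, y)\<close>. This turns error estimates into the inclusions used for existence and
  uniqueness.\<close>

lemma subset_if_fibre_near:
  fixes K L :: "('a::metric_space \<times> 'b::metric_space) set"
  assumes near: "\<And>n. fibre_near (r n) K L" and r: "r \<longlonglongrightarrow> 0" and L: "closed L"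
  shows "K \<subseteq> L"
proof (clarify)
  fix x y assume xy: "(x, y) \<in> K"
  have "\<exists>z. (x, z) \<in> L \<and> dist y z \<le> r n" for n
    using near[of n] xy by (auto simp: fibre_near_def)
  then obtain z where z: "\<And>n. (x, z n) \<in> L" "\<And>n. dist y (z n) \<le> r n" by metis
  have "(\<lambda>n. dist (z n) y) \<longlonglongrightarrow> 0"
    by (rule tendsto_sandwich[OF _ _ tendsto_const r]) (use z(2) in \<open>auto simp: dist_commute\<close>)
  then have "(\<lambda>n. (x, z n)) \<longlonglongrightarrow> (x, y)" by (intro tendsto_Pair tendsto_const) (rule tendsto_dist_iff[THEN iffD2])
  then show "(x, y) \<in> L" by (rule closed_sequentially[OF L z(1)])
qed

text \<open>Supplies the finite initial error that the contraction then shrinks.\<close>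

lemma compact_fibre_near_bound:
  fixes K L :: "('a::metric_space \<times> 'b::metric_space) set"
  assumes "compact K" "compact L" "fst ` K \<subseteq> fst ` L"
  obtains R where "0 \<le> R" "fibre_near R K L"
proof -
  have "bounded (snd ` (K \<union> L))"
    by (intro compact_imp_bounded compact_continuous_image continuous_intros compact_Un assms)
  then obtain R where R: "\<And>y z. y \<in> snd ` (K \<union> L) \<Longrightarrow> z \<in> snd ` (K \<union> L) \<Longrightarrow> dist y z \<le> R"
    unfolding bounded_two_points by blast
  \<comment> \<open>If both sets are empty, the diameter bound \<open>R\<close> may be
    negative.\<close>
  have "fibre_near (max 0 R) K L"
  proof (rule fibre_nearI)
    fix x y assume xy: "(x, y) \<in> K"
    then obtain z where z: "(x, z) \<in> L" using assms(3) by force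
    have "dist y z \<le> R" using xy z by (intro R) force+
    with z show "\<exists>z. (x, z) \<in> L \<and> dist y z \<le> max 0 R" by (intro exI[of _ z]) simp
  qed
  then show thesis by (intro that[of "max 0 R"]) auto
qed

section \<open>Limits of fibrewise Cauchy sequences of compact sets\<close>

lemma fibre_near_dist:
  assumes "fibre_near r K L" "p \<in> K"
  obtains q where "q \<in> L" "dist p q \<le> r"
proof -
  obtain z where "(fst p, z) \<in> L" "dist (snd p) z \<le> r"
    using assms by (metis fibre_nearE prod.collapse)
  then show thesis by (intro that[of "(fst p, z)"]) (auto simp: dist_prod_def)
qed

text \<open>Beyond some \<open>N\<close>, every \<open>K m\<close> is within \<open>r N\<close> of
  \<open>K N\<close>, so a finite net for the sets up to \<open>N\<close> serves the whole union.
  Completeness is inherited from \<open>Z\<close>.\<close>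

lemma compact_closure_fibre_Cauchy:
  fixes K :: "nat \<Rightarrow> ('a::metric_space \<times> 'b::metric_space) set"
  assumes K: "\<And>n. compact (K n)" "\<And>n. K n \<subseteq> Z" and Z: "complete Z"
    and near: "\<And>m n. n \<le> m \<Longrightarrow> fibre_near (r n) (K m) (K n)" and r: "r \<longlonglongrightarrow> 0"
  shows "compact (closure (\<Union>n. K n))"
  unfolding compact_eq_totally_bounded
proof (intro conjI allI impI)
  have "closure (\<Union>n. K n) \<subseteq> Z" using K(2) by (intro closure_minimal complete_imp_closed Z) auto
  then show "complete (closure (\<Union>n. K n))"
    using complete_Int_closed[OF Z closed_closure, of "\<Union>n. K n"] by (simp add: Int_absorb1)
  fix e :: real assume e: "e > 0"
  obtain N where N: "r N < e / 3"
    using order_tendstoD(2)[OF r, of "e / 3"] e by (auto simp: eventually_sequentially)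
  have "compact (\<Union>n\<le>N. K n)" using K(1) by (intro compact_UN) auto
  then obtain k where k: "finite k" "(\<Union>n\<le>N. K n) \<subseteq> (\<Union>x\<in>k. ball x (e / 3))"
    using e unfolding compact_eq_totally_bounded by (metis zero_less_divide_iff zero_less_numeral)
  \<comment> \<open>A finite union of closed balls is closed, hence contains the closure too; the
    radius \<open>2 * e / 3\<close> leaves room for open balls of radius \<open>e\<close>.\<close>
  have "(\<Union>n. K n) \<subseteq> (\<Union>x\<in>k. cball x (2 * e / 3))"
  proof (safe, unfold UN_iff)
    fix p m assume p: "p \<in> K m"
    obtain q where q: "q \<in> (\<Union>n\<le>N. K n)" "dist p q < e / 3"
    proof (cases "m \<le> N")
      case True
      then show ?thesis using p e by (intro that[of p]) auto
    next
      case False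
      then have "fibre_near (r N) (K m) (K N)" by (intro near) simp
      then obtain q where "q \<in> K N" "dist p q \<le> r N" using p by (rule fibre_near_dist)
      then show ?thesis using N by (intro that[of q]) auto
    qed
    then obtain x where "x \<in> k" "dist x q < e / 3" using k(2) by auto
    then show "\<exists>x\<in>k. p \<in> cball x (2 * e / 3)"
      using q(2) dist_triangle[of x p q] by (intro bexI[of _ x]) (auto simp: dist_commute)
  qed
  then have "closure (\<Union>n. K n) \<subseteq> (\<Union>x\<in>k. cball x (2 * e / 3))"
    using k(1) by (intro closure_minimal closed_UN) auto
  also have "\<dots> \<subseteq> (\<Union>x\<in>k. ball x e)" using e by (force simp: subset_iff)
  finally show "\<exists>k. finite k \<and> closure (\<Union>n. K n) \<subseteq> (\<Union>x\<in>k. ball x e)" using k(1) by blast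
qed

lemma fibre_Cauchy_limit:
  fixes K :: "nat \<Rightarrow> ('a::metric_space \<times> 'b::metric_space) set"
  assumes K: "\<And>n. compact (K n)" "\<And>n. K n \<subseteq> Z" and Z: "complete Z" and r: "r \<longlonglongrightarrow> 0"
    and near: "\<And>m n. n \<le> m \<Longrightarrow> fibre_near (r n) (K m) (K n)"
    and near': "\<And>m n. n \<le> m \<Longrightarrow> fibre_near (r n) (K n) (K m)"
  obtains L where "compact L" "L \<subseteq> Z"
    "\<And>n. fibre_near (r n) L (K n)" "\<And>n. fibre_near (r n) (K n) L"
proof
  define C where "C n = closure (\<Union>m\<in>{n..}. K m)" for n
  define L where "L = (\<Inter>n. C n)"
  have "compact (C 0)"
    unfolding C_def using compact_closure_fibre_Cauchy[OF K Z near r] by (simp)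
  moreover have "C n \<subseteq> C 0" for n unfolding C_def by (intro closure_mono UN_mono) auto
  moreover have "closed (C n)" for n by (simp add: C_def)
  ultimately have C: "compact (C n)" for n by (metis compact_Int_closed inf.absorb2)
  show "compact L" unfolding L_def using compact_Int_closed[OF C closed_INT, of UNIV C 0] C
    by (simp add: compact_imp_closed Int_absorb1 INT_lower)
  have "C 0 \<subseteq> Z" unfolding C_def using K(2) by (intro closure_minimal complete_imp_closed Z) auto
  then show "L \<subseteq> Z" by (auto simp: L_def)
  show "fibre_near (r n) L (K n)" for n
  proof -
    \<comment> \<open>Only the tail from \<open>n\<close> on is known to be near \<open>K n\<close>;
      this suffices, as \<open>L\<close> lies in its closure \<open>C n\<close>.\<close>
    have "fibre_near (r n) (\<Union>m\<in>{n..}. K m) (K n)" using near by (fastforce simp: fibre_near_def)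
    then have "fibre_near (r n) (C n) (K n)" unfolding C_def by (rule fibre_near_closure[OF _ K(1)])
    then show ?thesis by (auto simp: L_def fibre_near_def)
  qed
  show "fibre_near (r n) (K n) L" for n
  proof (rule fibre_nearI)
    fix x y assume xy: "(x, y) \<in> K n"
    \<comment> \<open>A point common to \<open>B\<close> and all \<open>C m\<close> is a partner of
      \<open>(x, y)\<close> in \<open>L\<close>. By compactness of \<open>C 0\<close>, finitely many
      \<open>m\<close> at a time are enough.\<close>
    define B where "B = {x} \<times> cball y (r n)"
    have "C 0 \<inter> (\<Inter>m\<in>UNIV. C m \<inter> B) \<noteq> {}"
    proof (rule compact_imp_fip_image[OF C])
      show "closed (C m \<inter> B)" for m unfolding B_def C_def by (intro closed_Int closed_Times) auto
      fix F :: "nat set" assume F: "finite F"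
      obtain M where M: "n \<le> M" "\<And>m. m \<in> F \<Longrightarrow> m \<le> M"
        using finite_nat_set_iff_bounded_le[of "insert n F"] F by auto
      obtain z where z: "(x, z) \<in> K M" "dist y z \<le> r n"
        using near'[OF M(1)] xy by (rule fibre_nearE)
      \<comment> \<open>The tails decrease, so one point of \<open>K M\<close> meets all conditions
        with \<open>m \<le> M\<close>.\<close>
      have "(x, z) \<in> C m" if "m \<le> M" for m
        unfolding C_def using z(1) that closure_subset by fastforce
      with z M have "(x, z) \<in> C 0 \<inter> (\<Inter>m\<in>F. C m \<inter> B)" by (auto simp: B_def)
      then show "C 0 \<inter> (\<Inter>m\<in>F. C m \<inter> B) \<noteq> {}" by blast
    qed
    then obtain p where "p \<in> L" "p \<in> B" by (auto simp: L_def)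
    then show "\<exists>z. (x, z) \<in> L \<and> dist y z \<le> r n" by (auto simp: B_def)
  qed
qed

lemma complete_Times:
  fixes A :: "'a::metric_space set" and B :: "'b::metric_space set"
  assumes "complete A" "complete B"
  shows "complete (A \<times> B)"
  unfolding complete_def
proof (intro allI impI, elim conjE)
  fix f :: "nat \<Rightarrow> 'a \<times> 'b" assume f: "\<forall>n. f n \<in> A \<times> B" "Cauchy f"
  obtain a where a: "a \<in> A" "(\<lambda>n. fst (f n)) \<longlonglongrightarrow> a"
    using f completeE[OF assms(1) _ Cauchy_fst[OF f(2)]] by (metis mem_Times_iff)
  obtain b where b: "b \<in> B" "(\<lambda>n. snd (f n)) \<longlonglongrightarrow> b"
    using f completeE[OF assms(2) _ Cauchy_snd[OF f(2)]] by (metis mem_Times_iff)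
  show "\<exists>l\<in>A \<times> B. f \<longlonglongrightarrow> l"
    using a b tendsto_Pair[OF a(2) b(2)] by (intro bexI[of _ "(a, b)"]) auto
qed

section \<open>Contraction and the fixed point argument\<close>

lemma fibre_near_skew_map:
  assumes near: "fibre_near r K L" and K: "K \<subseteq> I \<times> Y" and L: "L \<subseteq> I \<times> Y" and c: "0 \<le> c"
    and contr: "\<And>\<alpha> x y z. \<alpha> \<in> A \<Longrightarrow> x \<in> J \<alpha> \<Longrightarrow> y \<in> Y \<Longrightarrow> z \<in> Y \<Longrightarrow>
      dist (S \<alpha> (x, y)) (S \<alpha> (x, z)) \<le> c * dist y z"
  shows "fibre_near (c * r) (\<Union>\<alpha>\<in>A. skew_map (T \<alpha>) (S \<alpha>) ` {(x, y) \<in> K. x \<in> J \<alpha>})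
    (\<Union>\<alpha>\<in>A. skew_map (T \<alpha>) (S \<alpha>) ` {(x, y) \<in> L. x \<in> J \<alpha>})" (is "fibre_near _ _ ?V")
proof (rule fibre_nearI)
  fix u v assume "(u, v) \<in> (\<Union>\<alpha>\<in>A. skew_map (T \<alpha>) (S \<alpha>) ` {(x, y) \<in> K. x \<in> J \<alpha>})"
  then obtain \<alpha> x y where 1: "\<alpha> \<in> A" "x \<in> J \<alpha>" "(x, y) \<in> K" "u = T \<alpha> x" "v = S \<alpha> (x, y)"
    by (auto simp: skew_map_def)
  obtain z where z: "(x, z) \<in> L" "dist y z \<le> r" using near 1(3) by (rule fibre_nearE)
  have "dist (S \<alpha> (x, y)) (S \<alpha> (x, z)) \<le> c * dist y z" using 1 z K L by (intro contr) auto
  also have "\<dots> \<le> c * r" using z(2) c by (rule mult_left_mono)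
  finally have "dist v (S \<alpha> (x, z)) \<le> c * r" using 1 by simp
  moreover have "(u, S \<alpha> (x, z)) \<in> ?V"
    using 1 z(1) by (intro UN_I[of \<alpha>] image_eqI[of _ _ "(x, z)"]) (auto simp: skew_map_def)
  ultimately show "\<exists>w. (u, w) \<in> ?V \<and> dist v w \<le> c * r" by blast
qed

text \<open>Banach's fixed point argument, with the uniform Hausdorff distance expressed by
  \<open>fibre_near\<close>. The one-sided contraction hypothesis gets applied in both
  directions.\<close>

lemma ex1_fixpoint_usc_graphs:
  fixes I :: "'a::metric_space set" and Y :: "'b::metric_space set"
  assumes I: "compact I" and Y: "complete Y" "Y \<noteq> {}" and c: "0 < c" "c < 1"
    and closed: "\<And>K. K \<in> usc_graphs I Y \<Longrightarrow> \<Phi> K \<in> usc_graphs I Y"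
    and contr: "\<And>K L r. K \<in> usc_graphs I Y \<Longrightarrow> L \<in> usc_graphs I Y \<Longrightarrow> fibre_near r K L \<Longrightarrow>
      fibre_near (c * r) (\<Phi> K) (\<Phi> L)"
  shows "\<exists>!K. K \<in> usc_graphs I Y \<and> \<Phi> K = K"
proof (rule ex_ex1I)
  note G = usc_graphs_eq[OF I]
  have bound: "\<exists>R\<ge>0. fibre_near R K L \<and> fibre_near R L K"
    if "K \<in> usc_graphs I Y" "L \<in> usc_graphs I Y" for K L :: "('a \<times> 'b) set"
  proof -
    have KL: "compact K" "compact L" "fst ` K = fst ` L" using that unfolding G by auto
    obtain R where "0 \<le> R" "fibre_near R K L"
      using compact_fibre_near_bound[of K L] KL by auto
    moreover obtain R' where "0 \<le> R'" "fibre_near R' L K"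
      using compact_fibre_near_bound[of L K] KL by auto
    ultimately show ?thesis by (intro exI[of _ "max R R'"]) (auto intro: fibre_near_mono)
  qed
  have lim0: "(\<lambda>n. a * c ^ n) \<longlonglongrightarrow> 0" for a
    using tendsto_mult_right_zero[OF LIMSEQ_realpow_zero] c by simp
  obtain y0 where y0: "y0 \<in> Y" using Y by blast
  define K where "K n = (\<Phi> ^^ n) (I \<times> {y0})" for n
  \<comment> \<open>The iteration starts at the graph of the constant map with value
    \<open>{y0}\<close>.\<close>
  have "I \<times> {y0} \<in> usc_graphs I Y" unfolding G using I y0 by (auto intro: compact_Times)
  then have K: "K n \<in> usc_graphs I Y" for n by (induction n) (auto simp: K_def closed)
  obtain R where R: "0 \<le> R" "fibre_near R (K 0) (K 1)" "fibre_near R (K 1) (K 0)"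
    using bound[OF K K] by blast
  have step: "fibre_near (R * c ^ n) (K n) (K (Suc n)) \<and> fibre_near (R * c ^ n) (K (Suc n)) (K n)" for n
  proof (induction n)
    case 0
    show ?case using R by simp
  next
    case (Suc n)
    then have "fibre_near (c * (R * c ^ n)) (\<Phi> (K n)) (\<Phi> (K (Suc n)))"
      "fibre_near (c * (R * c ^ n)) (\<Phi> (K (Suc n))) (\<Phi> (K n))"
      by (auto intro: contr K)
    then show ?case by (simp add: K_def mult.left_commute)
  qed
  \<comment> \<open>The geometric tail: the sum of \<open>R * c ^ k\<close> over
    \<open>k \<ge> n\<close>.\<close>
  define r where "r n = R / (1 - c) * c ^ n" for n
  have r: "r \<longlonglongrightarrow> 0" unfolding r_def by (rule lim0)
  have r_pos: "0 \<le> r n" for n using R c by (simp add: r_def)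
  have r_Suc: "R * c ^ n + r (Suc n) = r n" for n using c by (simp add: r_def field_simps)
  have near: "fibre_near (r n) (K (n + k)) (K n) \<and> fibre_near (r n) (K n) (K (n + k))" for n k
  \<comment> \<open>Going first from \<open>n\<close> to \<open>Suc n\<close> and then using the
    hypothesis at \<open>Suc n\<close> gives a bound \<open>r n\<close> independent of
    \<open>k\<close>.\<close>
  proof (induction k arbitrary: n)
    case 0
    show ?case using fibre_near_refl[OF r_pos] by simp
  next
    case (Suc k)
    show ?case
      using fibre_near_trans[of "R * c ^ n" "K n" "K (Suc n)" "r (Suc n)" "K (n + Suc k)"]
        fibre_near_trans[of "r (Suc n)" "K (n + Suc k)" "K (Suc n)" "R * c ^ n" "K n"]
        step[of n] Suc.IH[of "Suc n"] r_Suc[of n] by (simp add: add.commute)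
  qed
  have "complete (I \<times> Y)" by (intro complete_Times compact_imp_complete I Y)
  then obtain L where L: "compact L" "L \<subseteq> I \<times> Y"
      "\<And>n. fibre_near (r n) L (K n)" "\<And>n. fibre_near (r n) (K n) L"
  proof (rule fibre_Cauchy_limit[of K _ r, rotated 2])
    show "compact (K n)" "K n \<subseteq> I \<times> Y" for n using K[of n] unfolding G by auto
    show "fibre_near (r n) (K m) (K n)" "fibre_near (r n) (K n) (K m)" if "n \<le> m" for m n
      using near[of n "m - n"] that by auto
  qed (use r in auto)
  have "fst ` L = I"
    using fibre_near_fst[OF L(3), of 0] fibre_near_fst[OF L(4), of 0] K[of 0] unfolding G by auto
  with L have LG: "L \<in> usc_graphs I Y" unfolding G by auto
  have K_Suc: "\<Phi> (K n) = K (Suc n)" for n by (simp add: K_def)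
  \<comment> \<open>\<open>K (Suc n)\<close> lies between \<open>\<Phi> L\<close> and
    \<open>L\<close>: it is within \<open>c * r n\<close> of the former and \<open>r (Suc n)\<close>
    of the latter.\<close>
  have lim: "(\<lambda>n. c * r n + r (Suc n)) \<longlonglongrightarrow> 0"
    using tendsto_add[OF tendsto_mult_right_zero[OF r] LIMSEQ_Suc[OF r]] by simp
  have "\<Phi> L = L"
  proof (rule equalityI)
    show "\<Phi> L \<subseteq> L"
    proof (rule subset_if_fibre_near[OF _ lim])
      show "fibre_near (c * r n + r (Suc n)) (\<Phi> L) L" for n
        using fibre_near_trans[OF contr[OF LG K L(3)] L(4)[of "Suc n", folded K_Suc]] .
    qed (use L in \<open>simp add: compact_imp_closed\<close>)
    show "L \<subseteq> \<Phi> L"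
    proof (rule subset_if_fibre_near[OF _ lim])
      show "fibre_near (c * r n + r (Suc n)) L (\<Phi> L)" for n
        using fibre_near_trans[OF L(3)[of "Suc n", folded K_Suc] contr[OF K LG L(4)]]
        by (simp add: add.commute)
    qed (use closed[OF LG] in \<open>simp add: G compact_imp_closed\<close>)
  qed
  with LG show "\<exists>K. K \<in> usc_graphs I Y \<and> \<Phi> K = K" by blast

  fix K L assume KL: "K \<in> usc_graphs I Y \<and> \<Phi> K = K" "L \<in> usc_graphs I Y \<and> \<Phi> L = L"
  \<comment> \<open>Contracting repeatedly leaves both fixed points unchanged but shrinks the error
    to \<open>R * c ^ n\<close>; exchanging the roles then yields equality.\<close>
  have "K \<subseteq> L" if KL: "K \<in> usc_graphs I Y \<and> \<Phi> K = K" "L \<in> usc_graphs I Y \<and> \<Phi> L = L" for K L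
  proof -
    obtain R where R: "fibre_near R K L" using bound[of K L] KL by blast
    have "fibre_near (R * c ^ n) K L" for n
    proof (induction n)
      case (Suc n)
      then show ?case using contr[of K L "R * c ^ n"] KL by (simp add: mult.left_commute)
    qed (use R in simp)
    then show ?thesis
      by (rule subset_if_fibre_near[OF _ lim0]) (use KL in \<open>simp add: G compact_imp_closed\<close>)
  qed
  then show "K = L" using KL by blast
qed

theorem theorem1:
  fixes I :: "'a::metric_space set" and Y :: "'b::metric_space set"
    and A :: "'k set"
    and J :: "'k \<Rightarrow> 'a set"
    and T :: "'k \<Rightarrow> 'a \<Rightarrow> 'a"
    and S :: "'k \<Rightarrow> 'a \<times> 'b \<Rightarrow> 'b"
    and c :: real
  assumes "compact I"
    and "complete Y" and "Y \<noteq> {}"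
    and "countable A"
    and "\<And>\<alpha>. \<alpha> \<in> A \<Longrightarrow> J \<alpha> \<subseteq> I \<and> compact (J \<alpha>)"
    and "(\<Union>\<alpha>\<in>A. J \<alpha>) = I"
    and "\<And>\<alpha>. \<alpha> \<in> A \<Longrightarrow> continuous_on (J \<alpha>) (T \<alpha>) \<and> T \<alpha> ` J \<alpha> \<subseteq> I"
    and "(\<Union>\<alpha>\<in>A. T \<alpha> ` J \<alpha>) = I"
    and "\<And>\<alpha>. \<alpha> \<in> A \<Longrightarrow> continuous_on (J \<alpha> \<times> Y) (S \<alpha>) \<and> S \<alpha> ` (J \<alpha> \<times> Y) \<subseteq> Y"
    and "0 < c" and "c < 1"
    and "\<And>\<alpha> x y z. \<alpha> \<in> A \<Longrightarrow> x \<in> J \<alpha> \<Longrightarrow> y \<in> Y \<Longrightarrow> z \<in> Y \<Longrightarrow>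
           dist (S \<alpha> (x, y)) (S \<alpha> (x, z)) \<le> c * dist y z"
    and "\<And>y. y \<in> Y \<Longrightarrow> totally_bounded {S \<alpha> (x, y) | \<alpha> x. \<alpha> \<in> A \<and> x \<in> J \<alpha>}"
  shows "\<exists>!K. K \<in> usc_graphs I Y \<and> Theta I Y A J T S K = K"
proof (rule ex1_fixpoint_usc_graphs)
  have sub: "\<And>\<alpha>. \<alpha> \<in> A \<Longrightarrow> J \<alpha> \<subseteq> I" "\<And>\<alpha>. \<alpha> \<in> A \<Longrightarrow> T \<alpha> ` J \<alpha> \<subseteq> I"
    "\<And>\<alpha>. \<alpha> \<in> A \<Longrightarrow> S \<alpha> ` (J \<alpha> \<times> Y) \<subseteq> Y" "I \<subseteq> (\<Union>\<alpha>\<in>A. T \<alpha> ` J \<alpha>)"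
    using assms(5,7,8,9) by auto
  show closed: "Theta I Y A J T S K \<in> usc_graphs I Y" if "K \<in> usc_graphs I Y" for K
    using assms(1,2) sub(2,4,1,3) assms(10-13) that by (rule Theta_in_usc_graphs)
  fix K L :: "('a \<times> 'b) set" and r
  assume K: "K \<in> usc_graphs I Y" and L: "L \<in> usc_graphs I Y" and near: "fibre_near r K L"
  note G = usc_graphs_eq[OF assms(1)]
  have KY: "K \<subseteq> I \<times> Y" and LY: "L \<subseteq> I \<times> Y" using K L unfolding G by auto
  have eq: "Theta I Y A J T S M =
      closure (\<Union>\<alpha>\<in>A. skew_map (T \<alpha>) (S \<alpha>) ` {(x, y) \<in> M. x \<in> J \<alpha>})" if "M \<subseteq> I \<times> Y" for M
    using assms(1,2) sub(2,3) that by (rule Theta_eq_closure)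
  \<comment> \<open>Compactness of the target allows the estimate for the unclosed images to pass to
    the closure.\<close>
  have "compact (Theta I Y A J T S L)" using closed[OF L] unfolding G by simp
  then show "fibre_near (c * r) (Theta I Y A J T S K) (Theta I Y A J T S L)"
    unfolding eq[OF KY]
  proof (rule fibre_near_closure[rotated])
    show "fibre_near (c * r) (\<Union>\<alpha>\<in>A. skew_map (T \<alpha>) (S \<alpha>) ` {(x, y) \<in> K. x \<in> J \<alpha>})
      (Theta I Y A J T S L)"
      using fibre_near_skew_map[OF near KY LY less_imp_le[OF assms(10)] assms(12)]
      by (rule fibre_near_mono) (auto simp: eq[OF LY] intro: subsetD[OF closure_subset])
  qed
qed (use assms in auto)

end
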